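(* Let $\Omega_i,\mathcal C_i$, $i=1,2$, be nonempty subsets of $\mathbb R^n$ with $\mathcal C_1,\mathcal C_2$ closed and convex. Put $\Omega:=\Omega_1\cap\Omega_2$ and $\mathcal C:=\mathcal C_1\cap\mathcal C_2$, let $\bar x\in\Omega\cap\mathcal C$, and let $\Omega_1,\Omega_2$ be locally closed around $\bar x$. Assume that $\{\Omega_1,\Omega_2\}$ satisfy the limiting qualification condition with respect to $\{\mathcal C_1,\mathcal C_2\}$ at $\bar x$ and that $\{\Omega_1,\Omega_2\}$ are normal-densed in $\{\mathcal C_1,\mathcal C_2\}$ at $\bar x$. Then $$N_{\mathcal C}(\bar x,\Omega)\subset N_{\mathcal C_1}(\bar x,\Omega_1)+N_{\mathcal C_2}(\bar x,\Omega_2).$$ Consequently, if $\mathcal C_2$ is a neighborhood of $\bar x$, then $$N_{\mathcal C}(\bar x,\Omega)=N_{\mathcal C_1}(\bar x,\Omega)\subset N_{\mathcal C_1}(\bar x,\Omega_1)+N(\bar x,\Omega_2).$$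
   Context: All spaces are finite-dimensional with scalar product $\langle\cdot,\cdot\rangle$ and a norm. $x_k\xrightarrow{A}\bar x$ means $x_k\to\bar x$ with $x_k\in A$ for all $k$. $\operatorname{bd}$ denotes boundary. A set is locally closed around a point if its intersection with every sufficiently small closed ball centered at the point is closed. For a closed convex set $\mathcal C$ and $\bar x\in\mathcal C$, put $\mathcal R(\bar x,\mathcal C):=\{x^*\mid\exists p>0:\ \bar x+px^*\in\mathcal C\}$. For a set $\Omega$ and $\bar x\in\Omega$, the Fréchet normal cone is $\hat N(\bar x,\Omega):=\{x^*\mid\limsup_{x\xrightarrow{\Omega}\bar x}\frac{\langle x^*,x-\bar x\rangle}{\|x-\bar x\|}\le0\}$ (limsup over $x\ne\bar x$; i.e. for every $\epsilon>0$ there is $\delta>0$ with $\langle x^*,x-\bar x\rangle\le\epsilon\|x-\bar x\|$ for all $x\in\Omega$, $\|x-\bar x\|\le\delta$), and the (Mordukhovich) limiting normal cone $N(\bar x,\Omega)$ to a locally closed set is the set of all limits $x^*=\lim x_k^*$ with $x_k^*\in\hat N(x_k,\Omega)$, $x_k\xrightarrow{\Omega}\bar x$. For $\bar x\in\Omega\cap\mathcal C$, the Fréchet normal cone to $\Omega$ at $\bar x$ with respect to $\mathcal C$ is $$\hat N_{\mathcal C}(\bar x,\Omega):=\Big\{x^*\mid\exists p>0:\ \bar x+px^*\in\mathcal C,\ \limsup_{x\xrightarrow{\Omega\cap\mathcal C}\bar x}\tfrac{\langle x^*,x-\bar x\rangle}{\|x-\bar x\|}\le0\Big\},$$ and the limiting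 normal cone with respect to $\mathcal C$, $N_{\mathcal C}(\bar x,\Omega)$, is the set of all $x^*$ for which there are $x_k\xrightarrow{\Omega\cap\mathcal C}\bar x$ and $x_k^*\in\hat N_{\mathcal C}(x_k,\Omega)$ with $x_k^*\to x^*$. Limiting qualification condition: $\{\Omega_1,\Omega_2\}$ satisfy the limiting qualification condition with respect to $\{\mathcal C_1,\mathcal C_2\}$ at $\bar x$ if, for any $x_{ik}\xrightarrow{\Omega_i\cap\mathcal C_i}\bar x$ and $x_{ik}^*\in\hat N_{\mathcal C_i}(x_{ik},\Omega_i)$ with $x_{ik}^*\to x_i^*$ ($i=1,2$), $x_{1k}^*+x_{2k}^*\to0$ implies $x_1^*=x_2^*=0$. Normal-densed: with $\Omega=\Omega_1\cap\Omega_2$ and $\mathcal C=\mathcal C_1\cap\mathcal C_2$, $\{\Omega_1,\Omega_2\}$ are normal-densed in $\{\mathcal C_1,\mathcal C_2\}$ at $\bar x$ if, whenever there are sequences $x_{ik}\xrightarrow{\Omega_i\cap\mathcal C_i}\bar x$, $x_k\xrightarrow{\Omega\cap\operatorname{bd}\mathcal C}\bar x$, $x_{ik}^*\in\hat N(x_{ik},\Omega_i\cap\mathcal C_i)$ ($i=1,2$), $x_k^*\in\mathcal R(x_k,\mathcal C)$ with $x_{ik}^*\to x_i^*$ for some $x_i^*$ ($i=1,2$) and $x_k^*\to x_1^*+x_2^*$, there exist sequences $\tilde x_{ik}\xrightarrow{\Omega_i\cap\mathcal C_i}\bar x$ and $\tilde x_{ik}^*\in\hat N_{\mathcal C_i}(\tilde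 x_{ik},\Omega_i)$ with $\tilde x_{ik}^*\to\tilde x_i^*$ for some $\tilde x_i^*$ ($i=1,2$), such that $\tilde x_1^*+\tilde x_2^*=x_1^*+x_2^*$, and $\max\{\|\tilde x_1^*\|,\|\tilde x_2^*\|\}>0$ whenever $\max\{\|x_1^*\|,\|x_2^*\|\}>0$. *)

theory Defs
  imports "HOL-Analysis.Analysis"
begin

text \<open>
  The cones carry no guard that the base point lies in the sets concerned; they are only ever
  evaluated at points that do.
\<close>

definition seq_to_in :: "(nat \<Rightarrow> 'a::topological_space) \<Rightarrow> 'a set \<Rightarrow> 'a \<Rightarrow> bool" where
  "seq_to_in x A a \<longleftrightarrow> (\<forall>k. x k \<in> A) \<and> x \<longlonglongrightarrow> a"

definition locally_closed_around :: "'a::metric_space set \<Rightarrow> 'a \<Rightarrow> bool" where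
  "locally_closed_around S a \<longleftrightarrow> (\<exists>r>0. \<forall>\<rho>. 0 < \<rho> \<and> \<rho> \<le> r \<longrightarrow> closed (S \<inter> cball a \<rho>))"

definition radial_dirs :: "'a::real_vector \<Rightarrow> 'a set \<Rightarrow> 'a set" where
  "radial_dirs a C = {v. \<exists>p>0. a + p *\<^sub>R v \<in> C}"

text \<open>
  The upper limit is taken in the extended reals along \<^term>\<open>at a within S\<close>, which leaves out
  the point \<^term>\<open>a\<close> itself; at an isolated point of \<^term>\<open>S\<close> it is minus infinity, so
  every vector is a normal there.
\<close>

definition frechet_normal_cone :: "'a::real_inner \<Rightarrow> 'a set \<Rightarrow> 'a set" where
  "frechet_normal_cone a S =
     {v. Limsup (at a within S) (\<lambda>x. ereal ((v \<bullet> (x - a)) / norm (x - a))) \<le> 0}"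

definition limiting_normal_cone :: "'a::real_inner \<Rightarrow> 'a set \<Rightarrow> 'a set" where
  "limiting_normal_cone a S =
     {v. \<exists>x w. seq_to_in x S a \<and> (\<forall>k. w k \<in> frechet_normal_cone (x k) S) \<and> w \<longlonglongrightarrow> v}"

definition frechet_normal_cone_wrt :: "'a::real_inner set \<Rightarrow> 'a \<Rightarrow> 'a set \<Rightarrow> 'a set" where
  "frechet_normal_cone_wrt C a S =
     {v. (\<exists>p>0. a + p *\<^sub>R v \<in> C) \<and>
         Limsup (at a within S \<inter> C) (\<lambda>x. ereal ((v \<bullet> (x - a)) / norm (x - a))) \<le> 0}"

definition limiting_normal_cone_wrt :: "'a::real_inner set \<Rightarrow> 'a \<Rightarrow> 'a set \<Rightarrow> 'a set" where
  "limiting_normal_cone_wrt C a S =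
     {v. \<exists>x w. seq_to_in x (S \<inter> C) a \<and>
               (\<forall>k. w k \<in> frechet_normal_cone_wrt C (x k) S) \<and> w \<longlonglongrightarrow> v}"

definition limiting_qualification_condition ::
  "'a::real_inner set \<Rightarrow> 'a set \<Rightarrow> 'a set \<Rightarrow> 'a set \<Rightarrow> 'a \<Rightarrow> bool" where
  "limiting_qualification_condition S1 S2 C1 C2 a \<longleftrightarrow>
     (\<forall>x1 x2 w1 w2 v1 v2.
        seq_to_in x1 (S1 \<inter> C1) a \<and> seq_to_in x2 (S2 \<inter> C2) a \<and>
        (\<forall>k. w1 k \<in> frechet_normal_cone_wrt C1 (x1 k) S1) \<and>
        (\<forall>k. w2 k \<in> frechet_normal_cone_wrt C2 (x2 k) S2) \<and>
        w1 \<longlonglongrightarrow> v1 \<and> w2 \<longlonglongrightarrow> v2 \<and>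
        (\<lambda>k. w1 k + w2 k) \<longlonglongrightarrow> 0
        \<longrightarrow> v1 = 0 \<and> v2 = 0)"

definition normal_densed ::
  "'a::real_inner set \<Rightarrow> 'a set \<Rightarrow> 'a set \<Rightarrow> 'a set \<Rightarrow> 'a \<Rightarrow> bool" where
  "normal_densed S1 S2 C1 C2 a \<longleftrightarrow>
     (\<forall>x1 x2 x w1 w2 w v1 v2.
        seq_to_in x1 (S1 \<inter> C1) a \<and> seq_to_in x2 (S2 \<inter> C2) a \<and>
        seq_to_in x ((S1 \<inter> S2) \<inter> frontier (C1 \<inter> C2)) a \<and>
        (\<forall>k. w1 k \<in> frechet_normal_cone (x1 k) (S1 \<inter> C1)) \<and>
        (\<forall>k. w2 k \<in> frechet_normal_cone (x2 k) (S2 \<inter> C2)) \<and>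
        (\<forall>k. w k \<in> radial_dirs (x k) (C1 \<inter> C2)) \<and>
        w1 \<longlonglongrightarrow> v1 \<and> w2 \<longlonglongrightarrow> v2 \<and> w \<longlonglongrightarrow> v1 + v2
        \<longrightarrow>
        (\<exists>y1 y2 u1 u2 z1 z2.
           seq_to_in y1 (S1 \<inter> C1) a \<and> seq_to_in y2 (S2 \<inter> C2) a \<and>
           (\<forall>k. u1 k \<in> frechet_normal_cone_wrt C1 (y1 k) S1) \<and>
           (\<forall>k. u2 k \<in> frechet_normal_cone_wrt C2 (y2 k) S2) \<and>
           u1 \<longlonglongrightarrow> z1 \<and> u2 \<longlonglongrightarrow> z2 \<and>
           z1 + z2 = v1 + v2 \<and>
           (max (norm v1) (norm v2) > 0 \<longrightarrow> max (norm z1) (norm z2) > 0)))"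

lemma Limsup_quotient_le_0_iff:
  fixes a v :: "'a::real_inner"
  shows "Limsup (at a within S) (\<lambda>x. ereal ((v \<bullet> (x - a)) / norm (x - a))) \<le> 0 \<longleftrightarrow>
    (\<forall>\<epsilon>>0. \<exists>\<delta>>0. \<forall>x\<in>S. norm (x - a) \<le> \<delta> \<longrightarrow> v \<bullet> (x - a) \<le> \<epsilon> * norm (x - a))"
    (is "?L \<longleftrightarrow> ?R")
proof
  assume L: ?L
  show ?R
  proof (intro allI impI)
    fix e :: real assume e: "e > 0"
    then have "Limsup (at a within S) (\<lambda>x. ereal ((v \<bullet> (x - a)) / norm (x - a))) < ereal e"
      using L by (simp add: order_le_less_trans)
    then have "\<forall>\<^sub>F x in at a within S. (v \<bullet> (x - a)) / norm (x - a) < e"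
      using Limsup_lessD by fastforce
    then obtain d where d: "d > 0"
      "\<And>x. x \<in> S \<Longrightarrow> x \<noteq> a \<Longrightarrow> dist x a < d \<Longrightarrow> (v \<bullet> (x - a)) / norm (x - a) < e"
      unfolding eventually_at by blast
    have "v \<bullet> (x - a) \<le> e * norm (x - a)" if "x \<in> S" "norm (x - a) \<le> d / 2" for x
    proof (cases "x = a")
      case False
      then have "(v \<bullet> (x - a)) / norm (x - a) < e"
        using d that by (simp add: dist_norm)
      then show ?thesis using False by (simp add: divide_simps)
    qed simp
    then show "\<exists>\<delta>>0. \<forall>x\<in>S. norm (x - a) \<le> \<delta> \<longrightarrow> v \<bullet> (x - a) \<le> e * norm (x - a)"
      using d(1) by (intro exI[of _ "d / 2"]) auto
  qed
next
  assume R: ?R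
  show ?L
  proof (rule ereal_le_epsilon2)
    fix e :: real assume e: "e > 0"
    with R obtain d where d: "d > 0"
      "\<And>x. x \<in> S \<Longrightarrow> norm (x - a) \<le> d \<Longrightarrow> v \<bullet> (x - a) \<le> e * norm (x - a)" by blast
    have "\<forall>\<^sub>F x in at a within S. ereal ((v \<bullet> (x - a)) / norm (x - a)) \<le> ereal e"
      unfolding eventually_at using d
      by (intro exI[of _ d]) (auto simp: dist_norm divide_simps)
    then show "Limsup (at a within S) (\<lambda>x. ereal ((v \<bullet> (x - a)) / norm (x - a))) \<le> 0 + ereal e"
      by (simp add: Limsup_bounded)
  qed
qed

end

theory Submission imports Defs begin

text \<open>
  The key is a fuzzy intersection rule: if \<open>w\<close> is a Frechet normal to \<open>A \<inter> B\<close> at \<open>a\<close>, then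
  minimising \<open>|x - (a + t w)|\<^sup>2 + j |x - y|\<^sup>2\<close> over \<open>(x, y) \<in> A \<times> B\<close> near \<open>a\<close>, with \<open>t\<close> small and
  \<open>j\<close> large, yields Frechet normals to \<open>A\<close> and to \<open>B\<close> at nearby points whose sum is close to \<open>w\<close>.
  Apply it to \<open>A = \<Omega>1 \<inter> C1\<close> and \<open>B = \<Omega>2 \<inter> C2\<close> along a sequence defining a limiting normal, scale
  both normals down to bounded size and pass to a convergent subsequence. At base points on
  the boundary of \<open>C1 \<inter> C2\<close> normal-densedness replaces the limits by limiting normals relative to
  \<open>C1\<close> and \<open>C2\<close>; at interior base points nothing is to be replaced. If the scaling factors tend
  to 0, this produces nonzero limiting normals with sum 0, contrary to the qualification
  condition; otherwise one divides by the limit factor.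
\<close>

section \<open>Frechet and relative normal cones: scaling and interior base points\<close>

lemma frechet_normal_cone_iff:
  "v \<in> frechet_normal_cone a S \<longleftrightarrow>
    (\<forall>\<epsilon>>0. \<exists>\<delta>>0. \<forall>x\<in>S. norm (x - a) \<le> \<delta> \<longrightarrow> v \<bullet> (x - a) \<le> \<epsilon> * norm (x - a))"
  by (simp add: frechet_normal_cone_def Limsup_quotient_le_0_iff)

lemma frechet_normal_cone_wrt_iff:
  "v \<in> frechet_normal_cone_wrt C a S \<longleftrightarrow> v \<in> radial_dirs a C \<and> v \<in> frechet_normal_cone a (S \<inter> C)"
  by (simp add: frechet_normal_cone_wrt_def frechet_normal_cone_def radial_dirs_def)

lemma radial_dirs_scale:
  assumes "v \<in> radial_dirs a C" "0 < s"
  shows "s *\<^sub>R v \<in> radial_dirs a C"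
proof -
  obtain p where "p > 0" "a + p *\<^sub>R v \<in> C" using assms by (auto simp: radial_dirs_def)
  then show ?thesis unfolding radial_dirs_def using assms(2)
    by (auto intro!: exI[of _ "p / s"])
qed

lemma frechet_normal_cone_scale:
  assumes v: "v \<in> frechet_normal_cone a S" and s: "0 < s"
  shows "s *\<^sub>R v \<in> frechet_normal_cone a S"
  unfolding frechet_normal_cone_iff
proof (intro allI impI)
  fix e :: real assume "e > 0"
  with s have "e / s > 0" by simp
  then obtain d where d: "d > 0"
    "\<And>x. x \<in> S \<Longrightarrow> norm (x - a) \<le> d \<Longrightarrow> v \<bullet> (x - a) \<le> e / s * norm (x - a)"
    using v unfolding frechet_normal_cone_iff by meson
  have "(s *\<^sub>R v) \<bullet> (x - a) \<le> e * norm (x - a)" if "x \<in> S" "norm (x - a) \<le> d" for x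
    using mult_left_mono[OF d(2)[OF that], of s] s by simp
  with d(1) show "\<exists>d>0. \<forall>x\<in>S. norm (x - a) \<le> d \<longrightarrow> (s *\<^sub>R v) \<bullet> (x - a) \<le> e * norm (x - a)"
    by blast
qed

lemma frechet_normal_cone_wrt_scale:
  assumes "v \<in> frechet_normal_cone_wrt C a S" "0 < s"
  shows "s *\<^sub>R v \<in> frechet_normal_cone_wrt C a S"
  using assms radial_dirs_scale frechet_normal_cone_scale
  unfolding frechet_normal_cone_wrt_iff by blast

lemma limiting_normal_cone_wrtI:
  assumes "seq_to_in x (S \<inter> C) a" "\<And>k. w k \<in> frechet_normal_cone_wrt C (x k) S" "w \<longlonglongrightarrow> v"
  shows "v \<in> limiting_normal_cone_wrt C a S"
  unfolding limiting_normal_cone_wrt_def using assms by blast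

lemma limiting_normal_coneI:
  assumes "seq_to_in x S a" "\<And>k. w k \<in> frechet_normal_cone (x k) S" "w \<longlonglongrightarrow> v"
  shows "v \<in> limiting_normal_cone a S"
  unfolding limiting_normal_cone_def using assms by blast

lemma limiting_normal_cone_wrt_scale:
  assumes "v \<in> limiting_normal_cone_wrt C a S" "0 < s"
  shows "s *\<^sub>R v \<in> limiting_normal_cone_wrt C a S"
proof -
  obtain x w where xw: "seq_to_in x (S \<inter> C) a"
    "\<And>k. w k \<in> frechet_normal_cone_wrt C (x k) S" "w \<longlonglongrightarrow> v"
    using assms(1) by (auto simp: limiting_normal_cone_wrt_def)
  have "(\<lambda>k. s *\<^sub>R w k) \<longlonglongrightarrow> s *\<^sub>R v" using xw(3) by (intro tendsto_intros)
  moreover have "s *\<^sub>R w k \<in> frechet_normal_cone_wrt C (x k) S" for k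
    using xw(2) assms(2) by (rule frechet_normal_cone_wrt_scale)
  ultimately show ?thesis using xw(1) by (intro limiting_normal_cone_wrtI)
qed

text \<open>Frechet normality is a local notion: near an interior point of \<open>C\<close> the sets
  \<open>S\<close> and \<open>S \<inter> C\<close> agree, so both upper limits run along the same
  filter.\<close>

lemma frechet_normal_cone_Int_interior:
  assumes "a \<in> interior C"
  shows "frechet_normal_cone a (S \<inter> C) = frechet_normal_cone a S"
proof -
  have "at a within S \<inter> C = at a within S"
    using assms interior_subset[of C] by (intro at_within_nhd[of a "interior C"]) auto
  then show ?thesis by (simp add: frechet_normal_cone_def)
qed

text \<open>Admitting all small steps, and not just one, lets the step be shortened further to meet
  a second constraint.\<close>

lemma radial_dirs_interior:
  fixes a :: "'a::real_normed_vector"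
  assumes "a \<in> interior C"
  obtains p where "0 < p" "\<And>q. 0 < q \<Longrightarrow> q \<le> p \<Longrightarrow> a + q *\<^sub>R v \<in> C"
proof -
  obtain e where e: "e > 0" "cball a e \<subseteq> C" using assms by (auto simp: mem_interior_cball)
  \<comment> \<open>The summand 1 keeps the denominator positive when \<open>v = 0\<close>.\<close>
  define p where "p = e / (norm v + 1)"
  have p: "p > 0" using e by (auto simp: p_def add_nonneg_pos)
  have "a + q *\<^sub>R v \<in> C" if "0 < q" "q \<le> p" for q
  proof -
    have "q * norm v \<le> p * (norm v + 1)" using that p by (intro mult_mono) auto
    also have "\<dots> = e" by (simp add: p_def add_nonneg_eq_0_iff)
    finally have "dist a (a + q *\<^sub>R v) \<le> e" using that by (simp add: dist_norm)
    then show ?thesis using e by auto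
  qed
  with p that show ?thesis by blast
qed

lemma frechet_normal_cone_wrt_interior:
  assumes "a \<in> interior C"
  shows "frechet_normal_cone_wrt C a S = frechet_normal_cone a S"
proof -
  have "v \<in> radial_dirs a C" for v
    using radial_dirs_interior[OF assms, of v] unfolding radial_dirs_def by blast
  then show ?thesis
    using frechet_normal_cone_Int_interior[OF assms, of S] frechet_normal_cone_wrt_iff by blast
qed

text \<open>Convexity puts the whole segment from \<open>a\<close> to
  \<open>a + p *\<^sub>R v\<close> in \<open>C\<close>, so the step can be shortened until it also
  stays in \<open>D\<close>. The Frechet part is local and does not see \<open>D\<close>.\<close>

lemma frechet_normal_cone_wrt_Int_interior:
  assumes C: "convex C" and a: "a \<in> C" "a \<in> interior D"
  shows "frechet_normal_cone_wrt (C \<inter> D) a S = frechet_normal_cone_wrt C a S"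
proof -
  have "v \<in> radial_dirs a (C \<inter> D)" if v: "v \<in> radial_dirs a C" for v
  proof -
    obtain p where p: "p > 0" "a + p *\<^sub>R v \<in> C" using v by (auto simp: radial_dirs_def)
    obtain q where q: "q > 0" "\<And>s. 0 < s \<Longrightarrow> s \<le> q \<Longrightarrow> a + s *\<^sub>R v \<in> D"
      using radial_dirs_interior[OF a(2)] by blast
    define s where "s = min p q"
    have s: "0 < s" "s \<le> p" "s \<le> q" using p q by (auto simp: s_def)
    have "(1 - s / p) *\<^sub>R a + (s / p) *\<^sub>R (a + p *\<^sub>R v) \<in> C"
      using p s a by (intro convexD[OF C]) auto
    also have "(1 - s / p) *\<^sub>R a + (s / p) *\<^sub>R (a + p *\<^sub>R v) = a + s *\<^sub>R v"
      using p by (simp add: algebra_simps)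
    finally show ?thesis using s q(2) unfolding radial_dirs_def by blast
  qed
  moreover have "radial_dirs a (C \<inter> D) \<subseteq> radial_dirs a C" by (auto simp: radial_dirs_def)
  moreover have "frechet_normal_cone a (S \<inter> (C \<inter> D)) = frechet_normal_cone a (S \<inter> C)"
    using frechet_normal_cone_Int_interior[OF a(2), of "S \<inter> C"] by (simp add: Int_assoc)
  ultimately show ?thesis using frechet_normal_cone_wrt_iff by blast
qed

section \<open>The fuzzy intersection rule\<close>

text \<open>A quadratic remainder is of smaller order than the norm.\<close>

lemma frechet_normal_cone_if_quadratic_bound:
  assumes "0 < r" "0 \<le> c"
    and "\<And>x. x \<in> S \<Longrightarrow> norm (x - a) \<le> r \<Longrightarrow> v \<bullet> (x - a) \<le> c * (norm (x - a))\<^sup>2"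
  shows "v \<in> frechet_normal_cone a S"
  unfolding frechet_normal_cone_iff
proof (intro allI impI)
  fix e :: real assume e: "e > 0"
  define d where "d = min r (e / (c + 1))"
  have d: "d > 0" using e assms by (simp add: d_def)
  have "v \<bullet> (x - a) \<le> e * norm (x - a)" if x: "x \<in> S" "norm (x - a) \<le> d" for x
  proof -
    have "c * norm (x - a) \<le> (c + 1) * (e / (c + 1))"
      using x assms(2) by (intro mult_mono) (auto simp: d_def)
    also have "\<dots> = e" using assms(2) by simp
    finally have "c * norm (x - a) * norm (x - a) \<le> e * norm (x - a)"
      by (intro mult_right_mono) auto
    with assms(3)[of x] x show ?thesis by (simp add: d_def power2_eq_square mult.assoc)
  qed
  with d show "\<exists>d>0. \<forall>x\<in>S. norm (x - a) \<le> d \<longrightarrow> v \<bullet> (x - a) \<le> e * norm (x - a)" by blast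
qed

text \<open>First-order condition: the vector is minus half the gradient of the objective at
  \<open>z\<close>. Expanding both squares about \<open>z\<close> turns minimality into a quadratic
  bound. The weight \<open>\<beta>\<close> is 1 for the variable attracted to \<open>c\<close> and 0
  for the other one.\<close>

lemma frechet_normal_cone_minimizer:
  fixes z :: "'a::real_inner"
  assumes r: "norm (z - a) < r" and j: "0 \<le> j" and \<beta>: "0 \<le> \<beta>"
    and min: "\<And>x. x \<in> S \<inter> cball a r \<Longrightarrow>
      \<beta> * (norm (z - c))\<^sup>2 + j * (norm (z - y))\<^sup>2 \<le> \<beta> * (norm (x - c))\<^sup>2 + j * (norm (x - y))\<^sup>2"
  shows "\<beta> *\<^sub>R (c - z) - j *\<^sub>R (z - y) \<in> frechet_normal_cone z S"
proof (rule frechet_normal_cone_if_quadratic_bound)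
  \<comment> \<open>The ball of this radius about \<open>z\<close> stays inside
    \<open>cball a r\<close>, where minimality is known.\<close>
  show "0 < r - norm (z - a)" using r by simp
  show "0 \<le> (\<beta> + j) / 2" using j \<beta> by simp
  fix x assume x: "x \<in> S" "norm (x - z) \<le> r - norm (z - a)"
  have "norm (x - a) \<le> norm (x - z) + norm (z - a)" using norm_triangle_ineq[of "x - z" "z - a"] by simp
  with x have "x \<in> cball a r" by (simp add: dist_norm norm_minus_commute)
  with x min[of x] have *: "\<beta> * (norm (z - c))\<^sup>2 + j * (norm (z - y))\<^sup>2
      \<le> \<beta> * (norm (x - c))\<^sup>2 + j * (norm (x - y))\<^sup>2" by simp
  have sq: "(norm (x - b))\<^sup>2 = (norm (x - z))\<^sup>2 + 2 * ((z - b) \<bullet> (x - z)) + (norm (z - b))\<^sup>2" for b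
    by (simp add: power2_norm_eq_inner algebra_simps inner_commute)
  have "(c - z) \<bullet> (x - z) = - ((z - c) \<bullet> (x - z))" by (simp add: algebra_simps)
  with * show "(\<beta> *\<^sub>R (c - z) - j *\<^sub>R (z - y)) \<bullet> (x - z) \<le> (\<beta> + j) / 2 * (norm (x - z))\<^sup>2"
    unfolding sq[of c] sq[of y] inner_diff_left[of "\<beta> *\<^sub>R (c - z)"] inner_scaleR_left
    by (simp add: ring_distribs)
qed

text \<open>As \<open>j\<close> grows, the minimisers cluster at a point of the diagonal, hence of
  \<open>A \<inter> B\<close>, where the Frechet inequality for \<open>w\<close> forces closeness to
  \<open>a\<close>. Optimality in \<open>x\<close> and in \<open>y\<close> separately gives the two
  normals, and the penalty terms cancel in their sum.\<close>

lemma fuzzy_intersection_rule: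
  fixes a w :: "'a::euclidean_space"
  assumes a: "a \<in> A" "a \<in> B" and r: "0 < r"
    and cl: "closed (A \<inter> cball a r)" "closed (B \<inter> cball a r)"
    and w: "w \<in> frechet_normal_cone a (A \<inter> B)" and \<epsilon>: "0 < \<epsilon>"
  obtains x y u v where "x \<in> A" "y \<in> B" "norm (x - a) < \<epsilon>" "norm (y - a) < \<epsilon>"
    "u \<in> frechet_normal_cone x A" "v \<in> frechet_normal_cone y B" "norm (u + v - w) < \<epsilon>"
proof -
  \<comment> \<open>The cluster point will satisfy \<open>norm (fst l - a) \<le> 2 * t * e\<close>;
    a third of \<open>\<epsilon>\<close> makes this strictly less than
    \<open>t * \<epsilon>\<close>.\<close>
  define e where "e = \<epsilon> / 3"
  have e: "e > 0" using \<epsilon> by (simp add: e_def)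
  obtain d where d: "d > 0"
    "\<And>x. x \<in> A \<inter> B \<Longrightarrow> norm (x - a) \<le> d \<Longrightarrow> w \<bullet> (x - a) \<le> e * norm (x - a)"
    using w e unfolding frechet_normal_cone_iff by meson
  define \<rho> where "\<rho> = min r d"
  have \<rho>: "\<rho> > 0" "\<rho> \<le> r" "\<rho> \<le> d" using r d by (auto simp: \<rho>_def)
  \<comment> \<open>The bound \<open>\<rho> / \<epsilon>\<close> keeps points within
    \<open>t * \<epsilon>\<close> of \<open>a\<close> strictly inside the balls that define
    \<open>K\<close>; the bound 1 puts them within \<open>\<epsilon>\<close> of
    \<open>a\<close>.\<close>
  define t where "t = min 1 (\<rho> / \<epsilon>)"
  have t: "t > 0" "t * \<epsilon> \<le> \<rho>" "t * \<epsilon> \<le> \<epsilon>" using \<rho> \<epsilon>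
    by (auto simp: t_def min_def field_simps)
  define c where "c = a + t *\<^sub>R w"
  define K where "K = (A \<inter> cball a \<rho>) \<times> (B \<inter> cball a \<rho>)"
  have "cball a r \<inter> cball a \<rho> = cball a \<rho>" using \<rho> by auto
  then have "A \<inter> cball a \<rho> = (A \<inter> cball a r) \<inter> cball a \<rho>"
    "B \<inter> cball a \<rho> = (B \<inter> cball a r) \<inter> cball a \<rho>" by blast+
  then have "compact K" unfolding K_def using cl
    by (metis compact_Times closed_Int_compact compact_cball)
  have aK: "(a, a) \<in> K" using a \<rho> by (simp add: K_def)
  define F where "F j p = (norm (fst p - c))\<^sup>2 + real j * (norm (fst p - snd p))\<^sup>2"
    for j :: nat and p :: "'a \<times> 'a"
  have "\<exists>p\<in>K. \<forall>q\<in>K. F j p \<le> F j q" for j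
    using \<open>compact K\<close> aK unfolding F_def
    by (intro continuous_attains_inf continuous_intros) auto
  then obtain p where p: "\<And>j. p j \<in> K" "\<And>j q. q \<in> K \<Longrightarrow> F j (p j) \<le> F j q" by metis
  \<comment> \<open>\<open>M\<close> is the value of \<open>F j\<close> at \<open>(a, a)\<close>,
    the same for every \<open>j\<close>.\<close>
  define M where "M = (norm (t *\<^sub>R w))\<^sup>2"
  have M: "F j (p j) \<le> M" for j
    using p(2)[OF aK, of j] by (simp add: F_def M_def c_def)
  obtain l \<sigma> where l: "l \<in> K" "strict_mono (\<sigma> :: nat \<Rightarrow> nat)" "(p \<circ> \<sigma>) \<longlonglongrightarrow> l"
    using \<open>compact K\<close> p(1) unfolding compact_def by meson
  have lim: "(\<lambda>j. fst (p (\<sigma> j))) \<longlonglongrightarrow> fst l" "(\<lambda>j. snd (p (\<sigma> j))) \<longlonglongrightarrow> snd l"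
    using tendsto_fst[OF l(3)] tendsto_snd[OF l(3)] by (simp_all add: o_def)
  \<comment> \<open>The penalty is bounded by \<open>M\<close> while its weight tends to infinity,
    so the two components merge in the limit.\<close>
  have "(norm (fst l - snd l))\<^sup>2 \<le> 0"
  proof (rule tendsto_le)
    show "(\<lambda>j. (norm (fst (p (\<sigma> j)) - snd (p (\<sigma> j))))\<^sup>2) \<longlonglongrightarrow> (norm (fst l - snd l))\<^sup>2"
      by (intro tendsto_intros lim)
    show "(\<lambda>j. M / real j) \<longlonglongrightarrow> 0" by (rule lim_const_over_n)
    have "(norm (fst (p (\<sigma> j)) - snd (p (\<sigma> j))))\<^sup>2 \<le> M / real j" if "j > 0" for j
    proof -
      have "real j * (norm (fst (p (\<sigma> j)) - snd (p (\<sigma> j))))\<^sup>2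
          \<le> real (\<sigma> j) * (norm (fst (p (\<sigma> j)) - snd (p (\<sigma> j))))\<^sup>2"
        using seq_suble[OF l(2), of j] by (intro mult_right_mono) auto
      also have "\<dots> \<le> F (\<sigma> j) (p (\<sigma> j))" by (simp add: F_def)
      also have "\<dots> \<le> M" by (rule M)
      finally show ?thesis using that by (simp add: field_simps)
    qed
    then show "\<forall>\<^sub>F j in sequentially. (norm (fst (p (\<sigma> j)) - snd (p (\<sigma> j))))\<^sup>2 \<le> M / real j"
      by (auto intro: eventually_sequentiallyI[of 1])
  qed simp
  then have diag: "snd l = fst l" by simp
  \<comment> \<open>Without the penalty, \<open>fst l\<close> is no farther from \<open>c\<close>
    than \<open>a\<close> is. Expanding the square about \<open>a\<close> bounds the squared
    distance to \<open>a\<close> by the linear term that the Frechet inequality controls.\<close>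
  have "(norm (fst l - c))\<^sup>2 \<le> M"
  proof (rule tendsto_upperbound)
    show "(\<lambda>j. (norm (fst (p (\<sigma> j)) - c))\<^sup>2) \<longlonglongrightarrow> (norm (fst l - c))\<^sup>2"
      by (intro tendsto_intros lim)
    have "(norm (fst (p (\<sigma> j)) - c))\<^sup>2 \<le> F (\<sigma> j) (p (\<sigma> j))" for j by (simp add: F_def)
    then show "\<forall>\<^sub>F j in sequentially. (norm (fst (p (\<sigma> j)) - c))\<^sup>2 \<le> M"
      using M order_trans by (intro always_eventually allI) blast
  qed simp
  moreover have "(norm (fst l - c))\<^sup>2 = (norm (fst l - a))\<^sup>2 - 2 * t * (w \<bullet> (fst l - a)) + M"
    unfolding c_def M_def power2_norm_eq_inner
    by (simp add: algebra_simps inner_commute power2_eq_square)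
  ultimately have "(norm (fst l - a))\<^sup>2 \<le> 2 * t * (w \<bullet> (fst l - a))" by simp
  also have "\<dots> \<le> 2 * t * (e * norm (fst l - a))"
  proof (rule mult_left_mono)
    show "w \<bullet> (fst l - a) \<le> e * norm (fst l - a)"
      using l(1) diag \<rho> by (intro d) (auto simp: K_def dist_norm norm_minus_commute)
  qed (use t in simp)
  finally have "norm (fst l - a) * norm (fst l - a) \<le> (2 * t * e) * norm (fst l - a)"
    by (simp add: power2_eq_square algebra_simps)
  then have "norm (fst l - a) \<le> 2 * t * e"
    using t e by (cases "fst l = a") (auto dest: mult_right_le_imp_le)
  also have "\<dots> < t * \<epsilon>" using t \<epsilon> by (simp add: e_def)
  finally have near: "norm (fst l - a) < t * \<epsilon>" .
  have "\<forall>\<^sub>F j in sequentially. norm (fst (p (\<sigma> j)) - a) < t * \<epsilon>"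
    by (rule order_tendstoD(2)[OF _ near]) (intro tendsto_intros lim)
  moreover have "\<forall>\<^sub>F j in sequentially. norm (snd (p (\<sigma> j)) - a) < t * \<epsilon>"
    by (rule order_tendstoD(2)[OF _ near]) (use lim(2) diag in \<open>auto intro!: tendsto_intros\<close>)
  ultimately have "\<forall>\<^sub>F j in sequentially. norm (fst (p (\<sigma> j)) - a) < t * \<epsilon> \<and> norm (snd (p (\<sigma> j)) - a) < t * \<epsilon>"
    by eventually_elim simp
  then obtain j where j: "norm (fst (p (\<sigma> j)) - a) < t * \<epsilon>" "norm (snd (p (\<sigma> j)) - a) < t * \<epsilon>"
    by (auto simp: eventually_sequentially)
  define m where "m = real (\<sigma> j)"
  obtain x y where xy: "p (\<sigma> j) = (x, y)" by force
  have near: "norm (x - a) < t * \<epsilon>" "norm (y - a) < t * \<epsilon>" using j xy by auto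
  have xyK: "x \<in> A" "y \<in> B" "(x, y) \<in> K" using p(1)[of "\<sigma> j"] xy by (auto simp: K_def)
  have min: "(norm (x - c))\<^sup>2 + m * (norm (x - y))\<^sup>2 \<le> (norm (x' - c))\<^sup>2 + m * (norm (x' - y'))\<^sup>2"
    if "(x', y') \<in> K" for x' y' using p(2)[OF that, of "\<sigma> j"] by (simp add: F_def xy m_def)
  \<comment> \<open>The factor \<open>1 / t\<close> undoes the scaling of \<open>w\<close> in
    \<open>c\<close>.\<close>
  define u where "u = (1 / t) *\<^sub>R (1 *\<^sub>R (c - x) - m *\<^sub>R (x - y))"
  define v where "v = (1 / t) *\<^sub>R (0 *\<^sub>R (c - y) - m *\<^sub>R (y - x))"
  have "1 *\<^sub>R (c - x) - m *\<^sub>R (x - y) \<in> frechet_normal_cone x A"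
  proof (rule frechet_normal_cone_minimizer)
    show "norm (x - a) < \<rho>" using near t by simp
    fix x' assume "x' \<in> A \<inter> cball a \<rho>"
    then show "1 * (norm (x - c))\<^sup>2 + m * (norm (x - y))\<^sup>2 \<le> 1 * (norm (x' - c))\<^sup>2 + m * (norm (x' - y))\<^sup>2"
      using min[of x' y] xyK by (simp add: K_def)
  qed (auto simp: m_def)
  then have u: "u \<in> frechet_normal_cone x A"
    unfolding u_def using t by (intro frechet_normal_cone_scale) auto
  have "0 *\<^sub>R (c - y) - m *\<^sub>R (y - x) \<in> frechet_normal_cone y B"
  proof (rule frechet_normal_cone_minimizer)
    show "norm (y - a) < \<rho>" using near t by simp
    fix y' assume "y' \<in> B \<inter> cball a \<rho>"
    then show "0 * (norm (y - c))\<^sup>2 + m * (norm (y - x))\<^sup>2 \<le> 0 * (norm (y' - c))\<^sup>2 + m * (norm (y' - x))\<^sup>2"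
      using min[of x y'] xyK by (simp add: K_def norm_minus_commute)
  qed (auto simp: m_def)
  then have v: "v \<in> frechet_normal_cone y B"
    unfolding v_def using t by (intro frechet_normal_cone_scale) auto
  \<comment> \<open>Only \<open>- (x - a) / t\<close> is left as error, which is why
    \<open>x\<close> was kept within \<open>t * \<epsilon>\<close> of \<open>a\<close> and not
    merely within \<open>\<epsilon>\<close>.\<close>
  have "u + v = (1 / t) *\<^sub>R ((1 *\<^sub>R (c - x) - m *\<^sub>R (x - y)) + (0 *\<^sub>R (c - y) - m *\<^sub>R (y - x)))"
    unfolding u_def v_def scaleR_add_right ..
  also have "\<dots> = (1 / t) *\<^sub>R (t *\<^sub>R w - (x - a))" by (simp add: c_def algebra_simps)
  also have "\<dots> = w - (1 / t) *\<^sub>R (x - a)" using t by (simp add: scaleR_diff_right)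
  finally have "u + v - w = - ((1 / t) *\<^sub>R (x - a))" by simp
  then have "norm (u + v - w) = norm (x - a) / t" using t by simp
  also have "\<dots> < \<epsilon>" using near t by (simp add: field_simps)
  finally have "norm (u + v - w) < \<epsilon>" .
  then show ?thesis using that[OF xyK(1,2) _ _ u v] near t by linarith
qed

section \<open>Limits of normals and the sum rule\<close>

text \<open>One radius serves all centres near \<open>a\<close>, because the fuzzy rule is applied
  at the moving points of a sequence.\<close>

lemma locally_closed_around_Int_closed:
  fixes a :: "'a::real_normed_vector"
  assumes "locally_closed_around S a" "closed C"
  obtains r where "0 < r" "\<And>x. norm (x - a) \<le> r \<Longrightarrow> closed (S \<inter> C \<inter> cball x r)"
proof -
  obtain R where R: "R > 0" "closed (S \<inter> cball a R)"
    using assms(1) by (auto simp: locally_closed_around_def)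
  have "closed (S \<inter> C \<inter> cball x (R / 2))" if "norm (x - a) \<le> R / 2" for x
  proof -
    have "dist a y \<le> R" if "dist x y \<le> R / 2" for y
      using dist_triangle[of a y x] that \<open>norm (x - a) \<le> R / 2\<close>
      by (simp add: dist_norm norm_minus_commute)
    then have "cball x (R / 2) \<subseteq> cball a R" by auto
    then have "S \<inter> C \<inter> cball x (R / 2) = (S \<inter> cball a R) \<inter> C \<inter> cball x (R / 2)" by blast
    then show ?thesis using R(2) assms(2) by (metis closed_Int closed_cball)
  qed
  with R(1) that[of "R / 2"] show ?thesis by simp
qed

lemma seq_to_in_subseq:
  assumes "seq_to_in x A a" "strict_mono (\<sigma> :: nat \<Rightarrow> nat)"
  shows "seq_to_in (x \<circ> \<sigma>) A a"
  using assms by (auto simp: seq_to_in_def LIMSEQ_subseq_LIMSEQ)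

text \<open>
  The conclusion of normal-densedness, extended to base points in the interior of \<open>C1 \<inter> C2\<close>, where
  \<open>v1\<close> and \<open>v2\<close> themselves serve.
\<close>

lemma normal_densed_limiting_normals:
  fixes a :: "'a::real_inner"
  assumes nd: "normal_densed S1 S2 C1 C2 a" and C: "closed C1" "closed C2"
    and x1: "seq_to_in x1 (S1 \<inter> C1) a" and x2: "seq_to_in x2 (S2 \<inter> C2) a"
    and x: "seq_to_in x ((S1 \<inter> S2) \<inter> (C1 \<inter> C2)) a"
    and u1: "\<And>k. u1 k \<in> frechet_normal_cone (x1 k) (S1 \<inter> C1)"
    and u2: "\<And>k. u2 k \<in> frechet_normal_cone (x2 k) (S2 \<inter> C2)"
    and w: "\<And>k. w k \<in> radial_dirs (x k) (C1 \<inter> C2)"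
    and lim: "u1 \<longlonglongrightarrow> v1" "u2 \<longlonglongrightarrow> v2" "w \<longlonglongrightarrow> v1 + v2"
    and int: "\<And>k. x k \<in> interior (C1 \<inter> C2) \<Longrightarrow> x1 k \<in> interior C1 \<and> x2 k \<in> interior C2"
  obtains z1 z2 where "z1 \<in> limiting_normal_cone_wrt C1 a S1"
    "z2 \<in> limiting_normal_cone_wrt C2 a S2" "z1 + z2 = v1 + v2"
    "v1 \<noteq> 0 \<Longrightarrow> z1 \<noteq> 0 \<or> z2 \<noteq> 0"
proof (cases "infinite {k. x k \<in> frontier (C1 \<inter> C2)}")
  case True
  then obtain \<sigma> :: "nat \<Rightarrow> nat" where \<sigma>: "strict_mono \<sigma>" "\<And>k. x (\<sigma> k) \<in> frontier (C1 \<inter> C2)"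
    using infinite_enumerate by blast
  have s: "seq_to_in (x1 \<circ> \<sigma>) (S1 \<inter> C1) a" "seq_to_in (x2 \<circ> \<sigma>) (S2 \<inter> C2) a"
    "seq_to_in (x \<circ> \<sigma>) ((S1 \<inter> S2) \<inter> frontier (C1 \<inter> C2)) a"
    using seq_to_in_subseq[OF x1 \<sigma>(1)] seq_to_in_subseq[OF x2 \<sigma>(1)] seq_to_in_subseq[OF x \<sigma>(1)] \<sigma>(2)
    by (auto simp: seq_to_in_def)
  have l: "(u1 \<circ> \<sigma>) \<longlonglongrightarrow> v1" "(u2 \<circ> \<sigma>) \<longlonglongrightarrow> v2" "(w \<circ> \<sigma>) \<longlonglongrightarrow> v1 + v2"
    using lim \<sigma>(1) by (simp_all add: LIMSEQ_subseq_LIMSEQ)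
  have n: "\<forall>k. (u1 \<circ> \<sigma>) k \<in> frechet_normal_cone ((x1 \<circ> \<sigma>) k) (S1 \<inter> C1)"
    "\<forall>k. (u2 \<circ> \<sigma>) k \<in> frechet_normal_cone ((x2 \<circ> \<sigma>) k) (S2 \<inter> C2)"
    "\<forall>k. (w \<circ> \<sigma>) k \<in> radial_dirs ((x \<circ> \<sigma>) k) (C1 \<inter> C2)"
    using u1 u2 w by auto
  obtain y1 y2 q1 q2 z1 z2 where *: "seq_to_in y1 (S1 \<inter> C1) a" "seq_to_in y2 (S2 \<inter> C2) a"
    "\<forall>k. q1 k \<in> frechet_normal_cone_wrt C1 (y1 k) S1"
    "\<forall>k. q2 k \<in> frechet_normal_cone_wrt C2 (y2 k) S2"
    "q1 \<longlonglongrightarrow> z1" "q2 \<longlonglongrightarrow> z2" "z1 + z2 = v1 + v2"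
    "max (norm v1) (norm v2) > 0 \<longrightarrow> max (norm z1) (norm z2) > 0"
    using nd[unfolded normal_densed_def, rule_format,
        of "x1 \<circ> \<sigma>" "x2 \<circ> \<sigma>" "x \<circ> \<sigma>" "u1 \<circ> \<sigma>" "u2 \<circ> \<sigma>" "w \<circ> \<sigma>" v1 v2] s l n
    by auto
  show ?thesis
  proof (rule that)
    show "z1 \<in> limiting_normal_cone_wrt C1 a S1" "z2 \<in> limiting_normal_cone_wrt C2 a S2"
      unfolding limiting_normal_cone_wrt_def using * by blast+
    show "z1 + z2 = v1 + v2" by fact
    show "z1 \<noteq> 0 \<or> z2 \<noteq> 0" if "v1 \<noteq> 0"
      using *(8) that by (auto simp: less_max_iff_disj)
  qed
next
  case False
  \<comment> \<open>Since \<open>C1 \<inter> C2\<close> is closed, base points off its frontier are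
    interior; this holds from \<open>N\<close> on, where Frechet normals to
    \<open>S1 \<inter> C1\<close> and \<open>S2 \<inter> C2\<close> are already relative
    normals.\<close>
  then obtain N where N: "\<And>k. x k \<in> frontier (C1 \<inter> C2) \<Longrightarrow> k < N"
    using finite_nat_set_iff_bounded by auto
  have sh: "strict_mono (\<lambda>k. k + N)" by (simp add: strict_mono_def)
  have "x (k + N) \<in> interior (C1 \<inter> C2)" for k
  proof -
    have "x (k + N) \<in> C1 \<inter> C2" using x by (auto simp: seq_to_in_def)
    moreover have "x (k + N) \<notin> frontier (C1 \<inter> C2)" using N[of "k + N"] by auto
    ultimately show ?thesis using C by (auto simp: frontier_def closure_closed closed_Int)
  qed
  then have int': "x1 (k + N) \<in> interior C1" "x2 (k + N) \<in> interior C2" for k using int by blast+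
  have n: "u1 (k + N) \<in> frechet_normal_cone_wrt C1 (x1 (k + N)) S1"
    "u2 (k + N) \<in> frechet_normal_cone_wrt C2 (x2 (k + N)) S2" for k
    using u1 u2 int' frechet_normal_cone_wrt_interior frechet_normal_cone_Int_interior by metis+
  have s: "seq_to_in (\<lambda>k. x1 (k + N)) (S1 \<inter> C1) a" "seq_to_in (\<lambda>k. x2 (k + N)) (S2 \<inter> C2) a"
    using seq_to_in_subseq[OF x1 sh] seq_to_in_subseq[OF x2 sh] by (simp_all add: o_def)
  have l: "(\<lambda>k. u1 (k + N)) \<longlonglongrightarrow> v1" "(\<lambda>k. u2 (k + N)) \<longlonglongrightarrow> v2"
    using lim by (simp_all add: LIMSEQ_ignore_initial_segment)
  show ?thesis
  proof (rule that)
    show "v1 \<in> limiting_normal_cone_wrt C1 a S1"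
      using s(1) n(1) l(1) by (rule limiting_normal_cone_wrtI)
    show "v2 \<in> limiting_normal_cone_wrt C2 a S2"
      using s(2) n(2) l(2) by (rule limiting_normal_cone_wrtI)
  qed auto
qed

text \<open>Sequences witnessing \<open>z1\<close> and \<open>z2\<close> have sums converging to
  \<open>z1 + z2\<close>, so the condition passes from sequences to their limits.\<close>

lemma limiting_qualification_conditionD:
  assumes "limiting_qualification_condition S1 S2 C1 C2 a"
    and "z1 \<in> limiting_normal_cone_wrt C1 a S1" "z2 \<in> limiting_normal_cone_wrt C2 a S2"
    and "z1 + z2 = 0"
  shows "z1 = 0" "z2 = 0"
proof -
  obtain x1 w1 x2 w2 where *: "seq_to_in x1 (S1 \<inter> C1) a" "seq_to_in x2 (S2 \<inter> C2) a"
    "\<forall>k. w1 k \<in> frechet_normal_cone_wrt C1 (x1 k) S1"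
    "\<forall>k. w2 k \<in> frechet_normal_cone_wrt C2 (x2 k) S2" "w1 \<longlonglongrightarrow> z1" "w2 \<longlonglongrightarrow> z2"
    using assms(2,3) unfolding limiting_normal_cone_wrt_def by blast
  have "(\<lambda>k. w1 k + w2 k) \<longlonglongrightarrow> 0"
    using tendsto_add[OF *(5,6)] assms(4) by simp
  with * assms(1) have "z1 = 0 \<and> z2 = 0" unfolding limiting_qualification_condition_def by blast
  then show "z1 = 0" "z2 = 0" by auto
qed

text \<open>The fuzzy rule is applied at the \<open>k\<close>-th base point with tolerance at most
  \<open>1 / (k + 1)\<close>. The last clause supplies what
  \<open>normal_densed_limiting_normals\<close> asks for at interior base points.\<close>

lemma limiting_normal_cone_wrt_approx:
  fixes a :: "'a::euclidean_space"
  assumes C: "closed C1" "closed C2"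
    and lc: "locally_closed_around S1 a" "locally_closed_around S2 a"
    and v: "v \<in> limiting_normal_cone_wrt (C1 \<inter> C2) a (S1 \<inter> S2)"
  obtains x w x1 x2 u1 u2 where "seq_to_in x ((S1 \<inter> S2) \<inter> (C1 \<inter> C2)) a"
    "\<And>k. w k \<in> radial_dirs (x k) (C1 \<inter> C2)" "w \<longlonglongrightarrow> v"
    "seq_to_in x1 (S1 \<inter> C1) a" "seq_to_in x2 (S2 \<inter> C2) a"
    "\<And>k. u1 k \<in> frechet_normal_cone (x1 k) (S1 \<inter> C1)"
    "\<And>k. u2 k \<in> frechet_normal_cone (x2 k) (S2 \<inter> C2)"
    "(\<lambda>k. u1 k + u2 k) \<longlonglongrightarrow> v"
    "\<And>k. x k \<in> interior (C1 \<inter> C2) \<Longrightarrow> x1 k \<in> interior C1 \<and> x2 k \<in> interior C2"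
proof -
  obtain X W where X: "seq_to_in X ((S1 \<inter> S2) \<inter> (C1 \<inter> C2)) a"
    and W: "\<And>k. W k \<in> frechet_normal_cone_wrt (C1 \<inter> C2) (X k) (S1 \<inter> S2)" "W \<longlonglongrightarrow> v"
    using v unfolding limiting_normal_cone_wrt_def by blast
  obtain r1 where r1: "r1 > 0" "\<And>x. norm (x - a) \<le> r1 \<Longrightarrow> closed (S1 \<inter> C1 \<inter> cball x r1)"
    using locally_closed_around_Int_closed[OF lc(1) C(1)] by blast
  obtain r2 where r2: "r2 > 0" "\<And>x. norm (x - a) \<le> r2 \<Longrightarrow> closed (S2 \<inter> C2 \<inter> cball x r2)"
    using locally_closed_around_Int_closed[OF lc(2) C(2)] by blast
  define r where "r = min r1 r2"
  have r: "r > 0" "r \<le> r1" "r \<le> r2" using r1 r2 by (auto simp: r_def)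
  have cl: "closed (S1 \<inter> C1 \<inter> cball x r)" "closed (S2 \<inter> C2 \<inter> cball x r)" if "norm (x - a) \<le> r" for x
  proof -
    have "S1 \<inter> C1 \<inter> cball x r = (S1 \<inter> C1 \<inter> cball x r1) \<inter> cball x r"
      "S2 \<inter> C2 \<inter> cball x r = (S2 \<inter> C2 \<inter> cball x r2) \<inter> cball x r" using r by auto
    then show "closed (S1 \<inter> C1 \<inter> cball x r)" "closed (S2 \<inter> C2 \<inter> cball x r)"
      using r1(2)[of x] r2(2)[of x] that r by (metis closed_Int closed_cball order_trans)+
  qed
  have "X \<longlonglongrightarrow> a" using X by (simp add: seq_to_in_def)
  \<comment> \<open>Dropping the first \<open>N\<close> terms leaves only base points at which
    \<open>cl\<close> gives closedness.\<close>
  then obtain N where N: "\<And>k. k \<ge> N \<Longrightarrow> norm (X k - a) < r" using LIMSEQ_D r(1) by metis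
  define x where "x k = X (k + N)" for k
  define w where "w k = W (k + N)" for k
  have sh: "strict_mono (\<lambda>k. k + N)" by (simp add: strict_mono_def)
  have x: "seq_to_in x ((S1 \<inter> S2) \<inter> (C1 \<inter> C2)) a"
    using seq_to_in_subseq[OF X sh] by (simp add: o_def x_def[abs_def])
  have wlim: "w \<longlonglongrightarrow> v" unfolding w_def[abs_def] using W(2) by (rule LIMSEQ_ignore_initial_segment)
  have w: "w k \<in> radial_dirs (x k) (C1 \<inter> C2)"
    "w k \<in> frechet_normal_cone (x k) ((S1 \<inter> S2) \<inter> (C1 \<inter> C2))" for k
    using W(1)[of "k + N"] by (auto simp: w_def x_def frechet_normal_cone_wrt_iff)
  have "\<exists>y1 y2 u1 u2. y1 \<in> S1 \<inter> C1 \<and> y2 \<in> S2 \<inter> C2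
      \<and> norm (y1 - x k) < inverse (real (Suc k)) \<and> norm (y2 - x k) < inverse (real (Suc k))
      \<and> u1 \<in> frechet_normal_cone y1 (S1 \<inter> C1) \<and> u2 \<in> frechet_normal_cone y2 (S2 \<inter> C2)
      \<and> norm (u1 + u2 - w k) < inverse (real (Suc k))
      \<and> (x k \<in> interior (C1 \<inter> C2) \<longrightarrow> y1 \<in> interior C1 \<and> y2 \<in> interior C2)" for k
  proof -
    \<comment> \<open>At an interior base point \<open>e\<close> keeps the new points interior too;
      at any other base point its value is arbitrary.\<close>
    obtain e where e: "e > 0" "x k \<in> interior (C1 \<inter> C2) \<Longrightarrow> ball (x k) e \<subseteq> interior (C1 \<inter> C2)"
      using open_interior open_contains_ball by (metis zero_less_one)
    define \<epsilon> where "\<epsilon> = min e (inverse (real (Suc k)))"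
    have \<epsilon>: "\<epsilon> > 0" "\<epsilon> \<le> e" "\<epsilon> \<le> inverse (real (Suc k))" using e(1) by (auto simp: \<epsilon>_def)
    have xk: "x k \<in> S1 \<inter> C1" "x k \<in> S2 \<inter> C2" "norm (x k - a) \<le> r"
      using x N[of "k + N"] by (auto simp: seq_to_in_def x_def)
    have "w k \<in> frechet_normal_cone (x k) ((S1 \<inter> C1) \<inter> (S2 \<inter> C2))"
      using w(2)[of k] by (simp add: Int_ac)
    from fuzzy_intersection_rule[OF xk(1,2) r(1) cl[OF xk(3)] this \<epsilon>(1)]
    obtain y1 y2 u1 u2 where y: "y1 \<in> S1 \<inter> C1" "y2 \<in> S2 \<inter> C2" "norm (y1 - x k) < \<epsilon>"
      "norm (y2 - x k) < \<epsilon>" "u1 \<in> frechet_normal_cone y1 (S1 \<inter> C1)"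
      "u2 \<in> frechet_normal_cone y2 (S2 \<inter> C2)" "norm (u1 + u2 - w k) < \<epsilon>" by blast
    have "y1 \<in> ball (x k) e" "y2 \<in> ball (x k) e"
      using y(3,4) \<epsilon>(2) by (auto simp: dist_norm norm_minus_commute)
    then have "x k \<in> interior (C1 \<inter> C2) \<longrightarrow> y1 \<in> interior C1 \<and> y2 \<in> interior C2"
      using e(2) unfolding interior_Int by blast
    then show ?thesis
      using y \<epsilon>(3) by (intro exI[of _ y1] exI[of _ y2] exI[of _ u1] exI[of _ u2]) auto
  qed
  then obtain x1 x2 u1 u2 where
    sel: "\<And>k. x1 k \<in> S1 \<inter> C1" "\<And>k. x2 k \<in> S2 \<inter> C2"
      "\<And>k. norm (x1 k - x k) < inverse (real (Suc k))" "\<And>k. norm (x2 k - x k) < inverse (real (Suc k))"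
      "\<And>k. u1 k \<in> frechet_normal_cone (x1 k) (S1 \<inter> C1)"
      "\<And>k. u2 k \<in> frechet_normal_cone (x2 k) (S2 \<inter> C2)"
      "\<And>k. norm (u1 k + u2 k - w k) < inverse (real (Suc k))"
      "\<And>k. x k \<in> interior (C1 \<inter> C2) \<Longrightarrow> x1 k \<in> interior C1 \<and> x2 k \<in> interior C2"
    by metis
  have close: "g \<longlonglongrightarrow> b" if "f \<longlonglongrightarrow> b" "\<And>k. norm (g k - f k) < inverse (real (Suc k))"
    for f g :: "nat \<Rightarrow> 'a" and b
  proof -
    have "(\<lambda>k. g k - f k) \<longlonglongrightarrow> 0"
      by (rule Lim_null_comparison[OF _ LIMSEQ_inverse_real_of_nat])
        (use that(2) in \<open>auto intro!: always_eventually less_imp_le\<close>)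
    from tendsto_add[OF this that(1)] show ?thesis by simp
  qed
  have "x \<longlonglongrightarrow> a" using x by (simp add: seq_to_in_def)
  then have "seq_to_in x1 (S1 \<inter> C1) a" "seq_to_in x2 (S2 \<inter> C2) a"
    using close sel unfolding seq_to_in_def by blast+
  moreover have "(\<lambda>k. u1 k + u2 k) \<longlonglongrightarrow> v" using close[OF wlim sel(7)] .
  ultimately show ?thesis using that[OF x w(1) wlim] sel by blast
qed

lemma limiting_normal_cone_wrt_Int_subset:
  fixes a :: "'a::euclidean_space"
  assumes C: "closed C1" "closed C2"
    and lc: "locally_closed_around S1 a" "locally_closed_around S2 a"
    and lqc: "limiting_qualification_condition S1 S2 C1 C2 a"
    and nd: "normal_densed S1 S2 C1 C2 a"
  shows "limiting_normal_cone_wrt (C1 \<inter> C2) a (S1 \<inter> S2)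
    \<subseteq> limiting_normal_cone_wrt C1 a S1 + limiting_normal_cone_wrt C2 a S2"
proof
  fix v assume "v \<in> limiting_normal_cone_wrt (C1 \<inter> C2) a (S1 \<inter> S2)"
  from limiting_normal_cone_wrt_approx[OF C lc this]
  obtain x w x1 x2 u1 u2 where x: "seq_to_in x ((S1 \<inter> S2) \<inter> (C1 \<inter> C2)) a"
    and w: "\<And>k. w k \<in> radial_dirs (x k) (C1 \<inter> C2)" "w \<longlonglongrightarrow> v"
    and x1: "seq_to_in x1 (S1 \<inter> C1) a" and x2: "seq_to_in x2 (S2 \<inter> C2) a"
    and u1: "\<And>k. u1 k \<in> frechet_normal_cone (x1 k) (S1 \<inter> C1)"
    and u2: "\<And>k. u2 k \<in> frechet_normal_cone (x2 k) (S2 \<inter> C2)"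
    and u12: "(\<lambda>k. u1 k + u2 k) \<longlonglongrightarrow> v"
    and int: "\<And>k. x k \<in> interior (C1 \<inter> C2) \<Longrightarrow> x1 k \<in> interior C1 \<and> x2 k \<in> interior C2"
    by blast
  \<comment> \<open>Both \<open>s k\<close> and the scaled \<open>u1 k\<close> stay bounded, and a
    genuine reduction (\<open>s k < 1\<close>) yields norm exactly 1. This excludes the limit factor
    0 later.\<close>
  define s where "s k = 1 / max 1 (norm (u1 k))" for k
  have s: "0 < s k" "s k \<le> 1" for k by (auto simp: s_def less_max_iff_disj)
  have su1: "norm (s k *\<^sub>R u1 k) \<le> 1" for k by (auto simp: s_def max_def field_simps)
  have su1_eq: "norm (s k *\<^sub>R u1 k) = 1" if "s k < 1" for k
    using that by (auto simp: s_def max_def split: if_splits)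
  have "bounded (range (\<lambda>k. (s k, s k *\<^sub>R u1 k)))"
  proof (rule bounded_subset)
    show "bounded ({0..1::real} \<times> cball (0::'a) 1)" by (intro bounded_Times) auto
    show "range (\<lambda>k. (s k, s k *\<^sub>R u1 k)) \<subseteq> {0..1} \<times> cball 0 1"
      using s su1 by (auto simp: less_imp_le)
  qed
  then obtain l \<sigma> where \<sigma>: "strict_mono (\<sigma> :: nat \<Rightarrow> nat)"
    "((\<lambda>k. (s k, s k *\<^sub>R u1 k)) \<circ> \<sigma>) \<longlonglongrightarrow> l"
    using bounded_imp_convergent_subsequence by blast
  obtain c v1 where l: "l = (c, v1)" by force
  have lim: "(\<lambda>k. s (\<sigma> k)) \<longlonglongrightarrow> c" "(\<lambda>k. s (\<sigma> k) *\<^sub>R u1 (\<sigma> k)) \<longlonglongrightarrow> v1"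
    using tendsto_fst[OF \<sigma>(2)] tendsto_snd[OF \<sigma>(2)] by (simp_all add: o_def l)
  \<comment> \<open>The scaled \<open>u2\<close> needs no bound of its own: it is the scaled sum,
    which tends to \<open>c *\<^sub>R v\<close>, minus the scaled \<open>u1\<close>.\<close>
  define v2 where "v2 = c *\<^sub>R v - v1"
  have "(\<lambda>k. s (\<sigma> k) *\<^sub>R (u1 (\<sigma> k) + u2 (\<sigma> k)) - s (\<sigma> k) *\<^sub>R u1 (\<sigma> k)) \<longlonglongrightarrow> v2"
    unfolding v2_def using LIMSEQ_subseq_LIMSEQ[OF u12 \<sigma>(1)]
    by (intro tendsto_intros lim) (simp add: o_def)
  then have lim2: "(\<lambda>k. s (\<sigma> k) *\<^sub>R u2 (\<sigma> k)) \<longlonglongrightarrow> v2" by (simp add: scaleR_add_right)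
  \<comment> \<open>The radial directions \<open>w\<close> and the sums \<open>u1 + u2\<close> share
    the limit \<open>v\<close>, so after scaling they still match, as normal-densedness
    requires.\<close>
  have limw: "(\<lambda>k. s (\<sigma> k) *\<^sub>R w (\<sigma> k)) \<longlonglongrightarrow> v1 + v2"
    unfolding v2_def using LIMSEQ_subseq_LIMSEQ[OF w(2) \<sigma>(1)]
    by (auto simp: o_def intro!: tendsto_intros lim)
  obtain z1 z2 where z: "z1 \<in> limiting_normal_cone_wrt C1 a S1"
    "z2 \<in> limiting_normal_cone_wrt C2 a S2" "z1 + z2 = v1 + v2"
    "v1 \<noteq> 0 \<Longrightarrow> z1 \<noteq> 0 \<or> z2 \<noteq> 0"
  proof (rule normal_densed_limiting_normals[OF nd C])
    show "seq_to_in (x1 \<circ> \<sigma>) (S1 \<inter> C1) a" "seq_to_in (x2 \<circ> \<sigma>) (S2 \<inter> C2) a"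
      "seq_to_in (x \<circ> \<sigma>) ((S1 \<inter> S2) \<inter> (C1 \<inter> C2)) a"
      by (intro seq_to_in_subseq x1 x2 x \<sigma>(1))+
    show "s (\<sigma> k) *\<^sub>R u1 (\<sigma> k) \<in> frechet_normal_cone ((x1 \<circ> \<sigma>) k) (S1 \<inter> C1)"
      "s (\<sigma> k) *\<^sub>R u2 (\<sigma> k) \<in> frechet_normal_cone ((x2 \<circ> \<sigma>) k) (S2 \<inter> C2)"
      "s (\<sigma> k) *\<^sub>R w (\<sigma> k) \<in> radial_dirs ((x \<circ> \<sigma>) k) (C1 \<inter> C2)" for k
      using u1 u2 w(1) s by (auto intro: frechet_normal_cone_scale radial_dirs_scale)
    show "(x1 \<circ> \<sigma>) k \<in> interior C1 \<and> (x2 \<circ> \<sigma>) k \<in> interior C2"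
      if "(x \<circ> \<sigma>) k \<in> interior (C1 \<inter> C2)" for k
      using int that by simp
    show "(\<lambda>k. s (\<sigma> k) *\<^sub>R u1 (\<sigma> k)) \<longlonglongrightarrow> v1" "(\<lambda>k. s (\<sigma> k) *\<^sub>R u2 (\<sigma> k)) \<longlonglongrightarrow> v2"
      "(\<lambda>k. s (\<sigma> k) *\<^sub>R w (\<sigma> k)) \<longlonglongrightarrow> v1 + v2"
      by (fact lim(2) lim2 limw)+
  qed (use that in blast)
  have sum: "z1 + z2 = c *\<^sub>R v" using z(3) by (simp add: v2_def)
  have "c \<ge> 0" using lim(1) s by (intro tendsto_lowerbound[OF lim(1)]) (auto simp: less_imp_le)
  \<comment> \<open>If \<open>c = 0\<close>, the scaled \<open>u1\<close> eventually has norm 1, so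
    \<open>v1\<close> is nonzero and hence \<open>z1\<close> or \<open>z2\<close> is; but
    \<open>z1 + z2 = 0\<close> then contradicts the qualification condition.\<close>
  moreover have "c \<noteq> 0"
  proof
    assume c: "c = 0"
    have "\<forall>\<^sub>F k in sequentially. s (\<sigma> k) < 1" using lim(1) c by (intro order_tendstoD) auto
    then have "\<forall>\<^sub>F k in sequentially. norm (s (\<sigma> k) *\<^sub>R u1 (\<sigma> k)) = 1"
      by eventually_elim (rule su1_eq)
    then have "(\<lambda>k. norm (s (\<sigma> k) *\<^sub>R u1 (\<sigma> k))) \<longlonglongrightarrow> 1" by (rule tendsto_eventually)
    with tendsto_norm[OF lim(2)] have "norm v1 = 1" using LIMSEQ_unique by blast
    moreover have "z1 = 0" "z2 = 0"
      using limiting_qualification_conditionD[OF lqc z(1,2)] sum c by auto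
    ultimately show False using z(4) by fastforce
  qed
  ultimately have c: "0 < 1 / c" by simp
  have "v = (1 / c) *\<^sub>R z1 + (1 / c) *\<^sub>R z2"
    using c sum by (simp flip: scaleR_add_right)
  then show "v \<in> limiting_normal_cone_wrt C1 a S1 + limiting_normal_cone_wrt C2 a S2"
    using limiting_normal_cone_wrt_scale[OF z(1) c] limiting_normal_cone_wrt_scale[OF z(2) c]
    by (simp add: set_plus_intro)
qed

section \<open>The case where the second convex set is a neighbourhood of the point\<close>

text \<open>Shifting the index turns "eventually" into "for all \<open>k\<close>", the form that the
  definitions of the limiting cones demand.\<close>

lemma seq_to_in_eventually_interior:
  assumes "seq_to_in x A a" "a \<in> interior D"
  obtains N where "\<And>k. x (k + N) \<in> interior D" "seq_to_in (\<lambda>k. x (k + N)) A a"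
proof -
  have "\<forall>\<^sub>F k in sequentially. x k \<in> interior D"
    using assms by (auto simp: seq_to_in_def intro: topological_tendstoD)
  then obtain N where "\<And>k. k \<ge> N \<Longrightarrow> x k \<in> interior D" by (auto simp: eventually_sequentially)
  moreover have "seq_to_in (\<lambda>k. x (k + N)) A a"
    using assms(1) by (auto simp: seq_to_in_def intro: LIMSEQ_ignore_initial_segment)
  ultimately show ?thesis by (intro that) auto
qed

text \<open>Along a tail of any defining sequence the base points are interior to \<open>D\<close>,
  where the two relative Frechet cones coincide.\<close>

lemma limiting_normal_cone_wrt_Int_interior:
  assumes "convex C" "a \<in> interior D"
  shows "limiting_normal_cone_wrt (C \<inter> D) a S = limiting_normal_cone_wrt C a S"
proof (intro equalityI subsetI)
  fix v assume "v \<in> limiting_normal_cone_wrt (C \<inter> D) a S"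
  then obtain x w where x: "seq_to_in x (S \<inter> (C \<inter> D)) a"
    and w: "\<And>k. w k \<in> frechet_normal_cone_wrt (C \<inter> D) (x k) S" "w \<longlonglongrightarrow> v"
    unfolding limiting_normal_cone_wrt_def by blast
  obtain N where N: "\<And>k. x (k + N) \<in> interior D" "seq_to_in (\<lambda>k. x (k + N)) (S \<inter> (C \<inter> D)) a"
    using seq_to_in_eventually_interior[OF x assms(2)] by blast
  have "x (k + N) \<in> C" for k using x by (auto simp: seq_to_in_def)
  then have "w (k + N) \<in> frechet_normal_cone_wrt C (x (k + N)) S" for k
    using w(1) frechet_normal_cone_wrt_Int_interior[OF assms(1) _ N(1)] by blast
  moreover have "seq_to_in (\<lambda>k. x (k + N)) (S \<inter> C) a" using N(2) by (auto simp: seq_to_in_def)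
  ultimately show "v \<in> limiting_normal_cone_wrt C a S"
    using LIMSEQ_ignore_initial_segment[OF w(2), of N] by (intro limiting_normal_cone_wrtI)
next
  fix v assume "v \<in> limiting_normal_cone_wrt C a S"
  then obtain x w where x: "seq_to_in x (S \<inter> C) a"
    and w: "\<And>k. w k \<in> frechet_normal_cone_wrt C (x k) S" "w \<longlonglongrightarrow> v"
    unfolding limiting_normal_cone_wrt_def by blast
  obtain N where N: "\<And>k. x (k + N) \<in> interior D" "seq_to_in (\<lambda>k. x (k + N)) (S \<inter> C) a"
    using seq_to_in_eventually_interior[OF x assms(2)] by blast
  have "x (k + N) \<in> C" for k using x by (auto simp: seq_to_in_def)
  then have "w (k + N) \<in> frechet_normal_cone_wrt (C \<inter> D) (x (k + N)) S" for k
    using w(1) frechet_normal_cone_wrt_Int_interior[OF assms(1) _ N(1)] by blast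
  moreover have "seq_to_in (\<lambda>k. x (k + N)) (S \<inter> (C \<inter> D)) a"
    using N interior_subset[of D] by (auto simp: seq_to_in_def)
  ultimately show "v \<in> limiting_normal_cone_wrt (C \<inter> D) a S"
    using LIMSEQ_ignore_initial_segment[OF w(2), of N] by (intro limiting_normal_cone_wrtI)
qed

lemma limiting_normal_cone_wrt_interior_subset:
  assumes "a \<in> interior D"
  shows "limiting_normal_cone_wrt D a S \<subseteq> limiting_normal_cone a S"
proof
  fix v assume "v \<in> limiting_normal_cone_wrt D a S"
  then obtain x w where x: "seq_to_in x (S \<inter> D) a"
    and w: "\<And>k. w k \<in> frechet_normal_cone_wrt D (x k) S" "w \<longlonglongrightarrow> v"
    unfolding limiting_normal_cone_wrt_def by blast
  obtain N where N: "\<And>k. x (k + N) \<in> interior D" "seq_to_in (\<lambda>k. x (k + N)) (S \<inter> D) a"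
    using seq_to_in_eventually_interior[OF x assms] by blast
  have "w (k + N) \<in> frechet_normal_cone (x (k + N)) S" for k
    using w(1) frechet_normal_cone_wrt_interior[OF N(1)] by blast
  moreover have "seq_to_in (\<lambda>k. x (k + N)) S a" using N(2) by (auto simp: seq_to_in_def)
  ultimately show "v \<in> limiting_normal_cone a S"
    using LIMSEQ_ignore_initial_segment[OF w(2), of N] by (intro limiting_normal_coneI)
qed

theorem theorem9:
  fixes \<Omega>1 \<Omega>2 C1 C2 :: "(real ^ 'n) set" and xbar :: "real ^ 'n"
  assumes "\<Omega>1 \<noteq> {}" and "\<Omega>2 \<noteq> {}" and "C1 \<noteq> {}" and "C2 \<noteq> {}"
    and "closed C1" and "convex C1" and "closed C2" and "convex C2"
    and "xbar \<in> (\<Omega>1 \<inter> \<Omega>2) \<inter> (C1 \<inter> C2)"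
    and "locally_closed_around \<Omega>1 xbar" and "locally_closed_around \<Omega>2 xbar"
    and "limiting_qualification_condition \<Omega>1 \<Omega>2 C1 C2 xbar"
    and "normal_densed \<Omega>1 \<Omega>2 C1 C2 xbar"
  shows "limiting_normal_cone_wrt (C1 \<inter> C2) xbar (\<Omega>1 \<inter> \<Omega>2)
           \<subseteq> limiting_normal_cone_wrt C1 xbar \<Omega>1 + limiting_normal_cone_wrt C2 xbar \<Omega>2
       \<and> (xbar \<in> interior C2 \<longrightarrow>
            limiting_normal_cone_wrt (C1 \<inter> C2) xbar (\<Omega>1 \<inter> \<Omega>2)
              = limiting_normal_cone_wrt C1 xbar (\<Omega>1 \<inter> \<Omega>2)
          \<and> limiting_normal_cone_wrt C1 xbar (\<Omega>1 \<inter> \<Omega>2)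
              \<subseteq> limiting_normal_cone_wrt C1 xbar \<Omega>1 + limiting_normal_cone xbar \<Omega>2)"
proof (intro conjI impI)
  show sub: "limiting_normal_cone_wrt (C1 \<inter> C2) xbar (\<Omega>1 \<inter> \<Omega>2)
      \<subseteq> limiting_normal_cone_wrt C1 xbar \<Omega>1 + limiting_normal_cone_wrt C2 xbar \<Omega>2"
    using assms by (intro limiting_normal_cone_wrt_Int_subset)
  assume int: "xbar \<in> interior C2"
  show eq: "limiting_normal_cone_wrt (C1 \<inter> C2) xbar (\<Omega>1 \<inter> \<Omega>2)
      = limiting_normal_cone_wrt C1 xbar (\<Omega>1 \<inter> \<Omega>2)"
    using assms int by (intro limiting_normal_cone_wrt_Int_interior)
  show "limiting_normal_cone_wrt C1 xbar (\<Omega>1 \<inter> \<Omega>2)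
      \<subseteq> limiting_normal_cone_wrt C1 xbar \<Omega>1 + limiting_normal_cone xbar \<Omega>2"
    using sub set_plus_mono2[OF subset_refl limiting_normal_cone_wrt_interior_subset[OF int]]
    unfolding eq by blast
qed

end
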